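(* The series $$(-q; q)_{\infty} + \sum_{k \geq 1} (-1)^k \sum_{m \geq 0} q^{\binom{3k+m}{2} - 3\binom{k}{2}} \begin{bmatrix} m+k-1 \\ k-1 \end{bmatrix}_{q^{-1}} \frac{(-q^{3k+m+1}; q)_{\infty}}{(q^2; q^2)_k}$$ is the generating function of partitions into distinct parts in which there can be no designated rafts. That is, for every integer $n \geq 0$, the coefficient of $q^n$ in this series is the number of partitions of $n$ into distinct positive parts in which no raft can be designated (i.e. which contain no raft).
   Context: All series are formal power series in $q$. The $q$-Pochhammer symbols are $(a;q)_n = \prod_{j=1}^{n}(1-aq^{j-1})$ for $n \in \mathbb{N}\cup\{\infty\}$, with $(a;q)_0=1$. The Gaussian polynomial is $\begin{bmatrix} N \\ r \end{bmatrix}_{q} = \frac{(q;q)_N}{(q;q)_r (q;q)_{N-r}}$ for $0\le r\le N$, and $\begin{bmatrix} N \\ r \end{bmatrix}_{q^{-1}}$ denotes the result of replacing $q$ by $q^{-1}$ in this polynomial. A partition into distinct parts is a finite strictly increasing sequence of positive integers (its parts), possibly empty; it is a partition of $n$ if its parts sum to $n$. A raft in a partition into distinct parts is a pair of consecutive integers $[k,k+1]$, both of which are parts, such that $k+2$ is not a part. Each raft in a partition may or may not be designated; a partition in which there can be no designated rafts is one having no rafts at all. *)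

theory Defs
  imports "HOL-Analysis.Analysis" "HOL-Computational_Algebra.Formal_Laurent_Series"
begin

text \<open>
  Series in \<open>q\<close> live in the field \<open>rat fls\<close> of formal Laurent series, with \<open>q = fls_X\<close>, so that
  \<open>q\<^sup>-\<^sup>1\<close> and the denominators are available. Infinite sums and products are limits in the metric
  topology of that type, in which two series are close if they agree up to a high power of \<open>q\<close>.
\<close>

definition qpoch :: "'a::comm_ring_1 \<Rightarrow> 'a \<Rightarrow> nat \<Rightarrow> 'a" where
  "qpoch a q n = (\<Prod>j=1..n. 1 - a * q ^ (j - 1))"

definition qpoch_inf :: "'a::{comm_ring_1, t2_space} \<Rightarrow> 'a \<Rightarrow> 'a" where
  "qpoch_inf a q = lim (\<lambda>n. qpoch a q n)"

text \<open>
  The base \<open>q\<close> is an arbitrary field element. The quotient equals the value at \<open>q\<close> of the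
  Gaussian polynomial whenever \<open>q\<close> is not a root of unity, in particular at \<open>q = inverse fls_X\<close>.
\<close>

definition gauss_binom :: "'a::field \<Rightarrow> nat \<Rightarrow> nat \<Rightarrow> 'a" where
  "gauss_binom q N r =
     (if r \<le> N then qpoch q q N / (qpoch q q r * qpoch q q (N - r)) else 0)"

definition distinct_partitions :: "nat \<Rightarrow> nat list set" where
  "distinct_partitions n =
     {xs. sorted_wrt (<) xs \<and> (\<forall>x\<in>set xs. 0 < x) \<and> sum_list xs = n}"

text \<open>The pair \<open>(k, k + 1)\<close> stands for the raft \<open>[k, k+1]\<close>.\<close>

definition rafts :: "nat list \<Rightarrow> (nat \<times> nat) set" where
  "rafts xs = {(k, k + 1) | k. k \<in> set xs \<and> k + 1 \<in> set xs \<and> k + 2 \<notin> set xs}"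

definition raftless_partitions :: "nat \<Rightarrow> nat list set" where
  "raftless_partitions n = {xs \<in> distinct_partitions n. rafts xs = {}}"

end

theory Submission
  imports Defs
begin

text \<open>
  A partition without rafts is a partition without two consecutive parts: the topmost pair of
  consecutive parts would be a raft. So the right-hand side is the generating function of partitions
  whose parts differ by at least two. Those with exactly \<open>N\<close> parts have generating function
  \<open>q^(N\<^sup>2) / (q;q)\<^sub>N\<close> (\<open>gap2_fps_closed_form\<close>), as in the first Rogers--Ramanujan identity.

  The left-hand side is an inclusion--exclusion over sets of designated rafts. Its inner sum is
  \<open>\<Sum>n. d(k, n)\<close> with
  \<open>d(k, n) = q^(3k\<^sup>2 + 2kn + n(n+1)/2) / ((q\<^sup>2;q\<^sup>2)\<^sub>k (q;q)\<^sub>n)\<close>,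
  the generating function of the partitions into \<open>2k + n\<close> distinct parts with \<open>k\<close> designated rafts.
  To see this algebraically, expand the infinite product by Euler's theorem
  \<open>(-q^(a+1);q)\<^sub>\<infinity> = \<Sum>j. q^(j(j+1)/2 + aj) / (q;q)\<^sub>j\<close>
  (\<open>qpoch_inf_eq_euler_sum\<close>) and collect the terms with \<open>m + j = n\<close>. What remains is
  a finite convolution of Gaussian polynomials in \<open>q\<^sup>-\<^sup>1\<close> with \<open>q^j / (q;q)\<^sub>j\<close>
  (\<open>sum_gauss_binom_inverse\<close>). It amounts to the identity
  \<open>1 / (\<Prod>i\<le>r. 1 - q^(-i) t) \<cdot> 1 / (qt;q)\<^sub>\<infinity> = 1 / (q^(-r) t;q)\<^sub>\<infinity>\<close> with \<open>r = k - 1\<close>.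

  The term outside the sum is \<open>\<Sum>n. d(0, n)\<close>. Now regroup the double sum of \<open>(-1)^k d(k, n)\<close>
  by the number \<open>N = 2k + n\<close> of parts. Each group is finite, and it is evaluated by comparing
  coefficients of \<open>t^N\<close> in \<open>(t\<^sup>2;q\<^sup>2)\<^sub>\<infinity> / (t;q)\<^sub>\<infinity> = (-t;q)\<^sub>\<infinity>\<close>
  (\<open>sum_even_qpoch_alternating\<close>), which gives \<open>q^(N\<^sup>2) / (q;q)\<^sub>N\<close> again.

  The rearrangements of infinite sums are harmless because the order of vanishing of the terms tends
  to infinity (\<open>summable_on_flsI\<close>); they rest on the continuity of addition in the \<open>q\<close>-adic topology.
\<close>

section \<open>Convergence of formal Laurent series\<close>

lemma dist_fls_less_iff:
  fixes a b :: "'a::group_add fls"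
  shows "dist a b < inverse (2 ^ n) \<longleftrightarrow> (\<forall>i\<le>int n. fls_nth a i = fls_nth b i)"
proof (cases "a = b")
  case True
  then show ?thesis by simp
next
  case False
  have "dist a b < inverse (2 ^ n) \<longleftrightarrow> int n < fls_subdegree (a - b)"
  proof (cases "fls_subdegree (a - b) \<ge> 0")
    case True
    have "inverse ((2::real) ^ nat (fls_subdegree (a - b))) < inverse (2 ^ n) \<longleftrightarrow>
        n < nat (fls_subdegree (a - b))"
      by simp
    with True False show ?thesis by (auto simp: dist_fls_def)
  next
    case neg: False
    have "inverse ((2::real) ^ n) \<le> 1" by (simp add: inverse_le_1_iff)
    also have "(1::real) \<le> 2 ^ nat (- fls_subdegree (a - b))" by simp
    finally show ?thesis using neg False by (auto simp: dist_fls_def)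
  qed
  also have "\<dots> \<longleftrightarrow> (\<forall>i\<le>int n. fls_nth (a - b) i = 0)"
  proof
    assume "int n < fls_subdegree (a - b)"
    then show "\<forall>i\<le>int n. fls_nth (a - b) i = 0" by (intro allI impI fls_eq0_below_subdegree) simp
  next
    assume *: "\<forall>i\<le>int n. fls_nth (a - b) i = 0"
    have "int n + 1 \<le> fls_subdegree (a - b)"
      by (rule fls_subdegree_geI) (use * False in auto)
    then show "int n < fls_subdegree (a - b)" by simp
  qed
  finally show ?thesis by simp
qed

text \<open>
  Small balls consist of the series that agree in all coefficients below a large degree. As the
  agreement covers all negative indices at once, this is stronger than convergence of each coefficient.
\<close>

lemma tendsto_fls_iff:
  fixes f :: "'b \<Rightarrow> 'a::group_add fls"
  shows "(f \<longlongrightarrow> l) F \<longleftrightarrow> (\<forall>N. \<forall>\<^sub>F x in F. \<forall>i<int N. fls_nth (f x) i = fls_nth l i)"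
proof
  assume lim: "(f \<longlongrightarrow> l) F"
  show "\<forall>N. \<forall>\<^sub>F x in F. \<forall>i<int N. fls_nth (f x) i = fls_nth l i"
  proof
    fix N
    have "\<forall>\<^sub>F x in F. dist (f x) l < inverse (2 ^ N)"
      using lim by (rule tendstoD) simp
    then show "\<forall>\<^sub>F x in F. \<forall>i<int N. fls_nth (f x) i = fls_nth l i"
      by eventually_elim (simp add: dist_fls_less_iff)
  qed
next
  assume *: "\<forall>N. \<forall>\<^sub>F x in F. \<forall>i<int N. fls_nth (f x) i = fls_nth l i"
  show "(f \<longlongrightarrow> l) F"
  proof (rule tendstoI)
    fix e :: real assume "e > 0"
    then obtain n where n: "inverse (2 ^ n) < e"
      using real_arch_pow_inv[of e "1/2"] by (auto simp: power_one_over inverse_eq_divide)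
    have "\<forall>\<^sub>F x in F. \<forall>i<int (Suc n). fls_nth (f x) i = fls_nth l i" using * by blast
    then show "\<forall>\<^sub>F x in F. dist (f x) l < e"
    proof eventually_elim
      case (elim x)
      then have "dist (f x) l < inverse (2 ^ n)" by (simp add: dist_fls_less_iff)
      with n show ?case by simp
    qed
  qed
qed

text \<open>
  Continuity of addition makes the general theorems on rearranging and nesting infinite sums available.
\<close>

instance fls :: (ab_group_add) topological_comm_monoid_add
proof
  fix a b :: "'a fls"
  have "\<forall>\<^sub>F x in nhds a \<times>\<^sub>F nhds b. \<forall>i<int N. fls_nth (fst x + snd x) i = fls_nth (a + b) i" for N
  proof -
    have nb: "\<forall>\<^sub>F x in nhds c. \<forall>i<int N. fls_nth x i = fls_nth c i" for c :: "'a fls"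
      using tendsto_ident_at[of c UNIV] tendsto_fls_iff[of "\<lambda>x. x" c "nhds c"]
      by (simp add: filterlim_ident)
    have "\<forall>\<^sub>F x in nhds a \<times>\<^sub>F nhds b. (\<forall>i<int N. fls_nth (fst x) i = fls_nth a i)
            \<and> (\<forall>i<int N. fls_nth (snd x) i = fls_nth b i)"
      using eventually_prodI[OF nb nb] by (simp add: case_prod_beta)
    then show ?thesis by eventually_elim simp
  qed
  then show "((\<lambda>x. fst x + snd x) \<longlongrightarrow> a + b) (nhds a \<times>\<^sub>F nhds b)"
    by (simp add: tendsto_fls_iff)
qed

text \<open>
  The degree bound \<open>d\<close> is a lower bound on the order of vanishing. If it exceeds any given \<open>N\<close> outside
  a finite set, each coefficient of the sum is a finite sum.
\<close>

lemma has_sum_flsI: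
  fixes f :: "'b \<Rightarrow> 'a::ab_group_add fls" and d :: "'b \<Rightarrow> nat"
  assumes ord: "\<And>x i. x \<in> A \<Longrightarrow> i < int (d x) \<Longrightarrow> fls_nth (f x) i = 0"
    and fin: "\<And>N. finite {x \<in> A. d x < N}"
    and S: "\<And>n. fls_nth S (int n) = (\<Sum>x | x \<in> A \<and> d x \<le> n. fls_nth (f x) (int n))"
    and S_neg: "\<And>i. i < 0 \<Longrightarrow> fls_nth S i = 0"
  shows "(f has_sum S) A"
  unfolding has_sum_def tendsto_fls_iff
proof
  fix N
  have "fls_nth (sum f X) i = fls_nth S i"
    if X: "finite X" "{x \<in> A. d x < N} \<subseteq> X" "X \<subseteq> A" and i: "i < int N" for X i
  proof (cases "i < 0")
    case True
    then show ?thesis using X(3) by (auto simp: fls_nth_sum S_neg intro!: sum.neutral ord)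
  next
    case False
    then obtain n where n: "i = int n" by (metis int_nat_eq not_le)
    have "fls_nth (sum f X) i = (\<Sum>x\<in>X. fls_nth (f x) (int n))" by (simp add: fls_nth_sum n)
    also have "\<dots> = (\<Sum>x | x \<in> A \<and> d x \<le> n. fls_nth (f x) (int n))"
    proof (rule sum.mono_neutral_right)
      show "\<forall>x\<in>X - {x \<in> A. d x \<le> n}. fls_nth (f x) (int n) = 0"
        using X(3) by (auto intro!: ord)
    qed (use X i n in auto)
    finally show ?thesis by (simp add: S n)
  qed
  then show "\<forall>\<^sub>F X in finite_subsets_at_top A. \<forall>i<int N. fls_nth (sum f X) i = fls_nth S i"
    unfolding eventually_finite_subsets_at_top using fin[of N]
    by (intro exI[of _ "{x \<in> A. d x < N}"]) auto
qed

lemma summable_on_flsI: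
  fixes f :: "'b \<Rightarrow> 'a::ab_group_add fls" and d :: "'b \<Rightarrow> nat"
  assumes "\<And>x i. x \<in> A \<Longrightarrow> i < int (d x) \<Longrightarrow> fls_nth (f x) i = 0"
    and "\<And>N. finite {x \<in> A. d x < N}"
  shows "f summable_on A"
proof -
  let ?S = "fps_to_fls (Abs_fps (\<lambda>n. \<Sum>x | x \<in> A \<and> d x \<le> n. fls_nth (f x) (int n)))"
  have "(f has_sum ?S) A"
    by (rule has_sum_flsI[where d = d]) (use assms in auto)
  then show ?thesis by (auto simp: summable_on_def)
qed

lemma fls_nth_mult_eq0:
  fixes f g :: "'a::{comm_monoid_add,mult_zero} fls"
  assumes "\<And>i. i < N \<Longrightarrow> fls_nth g i = 0" "i < fls_subdegree f + N"
  shows "fls_nth (f * g) i = 0"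
proof (cases "g = 0")
  case False
  then have "N \<le> fls_subdegree g" using assms(1) by (intro fls_subdegree_geI) auto
  with assms(2) show ?thesis by (intro fls_times_nth_eq0) simp
qed simp

lemma tendsto_fls_mult_left:
  fixes c :: "'a::ring fls"
  assumes "(f \<longlongrightarrow> l) F"
  shows "((\<lambda>x. c * f x) \<longlongrightarrow> c * l) F"
  unfolding tendsto_fls_iff
proof
  fix N
  define M where "M = nat (int N - fls_subdegree c)"
  have "\<forall>\<^sub>F x in F. \<forall>i<int M. fls_nth (f x) i = fls_nth l i"
    using assms unfolding tendsto_fls_iff by blast
  then show "\<forall>\<^sub>F x in F. \<forall>i<int N. fls_nth (c * f x) i = fls_nth (c * l) i"
  proof eventually_elim
    case (elim x)
    have "fls_nth (c * (f x - l)) i = 0" if "i < int N" for i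
      by (rule fls_nth_mult_eq0[where N = "int M"]) (use elim that in \<open>auto simp: M_def\<close>)
    then show ?case by (simp add: right_diff_distrib)
  qed
qed

lemma has_sum_fls_mult_left:
  fixes c :: "'a::ring fls"
  assumes "(f has_sum S) A"
  shows "((\<lambda>x. c * f x) has_sum c * S) A"
  using tendsto_fls_mult_left[of "sum f" S _ c] assms by (simp add: has_sum_def sum_distrib_left)

lemma has_sum_fls_nth_eq0:
  fixes f :: "'b \<Rightarrow> 'a::ab_group_add fls"
  assumes "(f has_sum S) A" and "\<And>x. x \<in> A \<Longrightarrow> fls_nth (f x) i = 0"
  shows "fls_nth S i = 0"
proof -
  have "\<forall>\<^sub>F X in finite_subsets_at_top A. \<forall>l<int (nat (i + 1)). fls_nth (sum f X) l = fls_nth S l"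
    using assms(1) unfolding has_sum_def tendsto_fls_iff by blast
  moreover have "\<forall>\<^sub>F X in finite_subsets_at_top A. X \<subseteq> A"
    by (rule eventually_finite_subsets_at_top_weakI)
  ultimately have "\<forall>\<^sub>F X in finite_subsets_at_top A.
      (\<forall>l<int (nat (i + 1)). fls_nth (sum f X) l = fls_nth S l) \<and> X \<subseteq> A"
    by (rule eventually_conj)
  from eventually_happens'[OF finite_subsets_at_top_neq_bot this]
  obtain X where "X \<subseteq> A" "\<forall>l<int (nat (i + 1)). fls_nth (sum f X) l = fls_nth S l"
    by blast
  then have "fls_nth S i = fls_nth (sum f X) i" by simp
  also have "\<dots> = 0" using assms(2) \<open>X \<subseteq> A\<close> by (auto simp: fls_nth_sum intro!: sum.neutral)
  finally show ?thesis .
qed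

section \<open>Finite identities for Pochhammer symbols and Gaussian polynomials\<close>

lemma qpoch_0 [simp]: "qpoch a q 0 = 1"
  by (simp add: qpoch_def)

lemma qpoch_Suc: "qpoch a q (Suc n) = qpoch a q n * (1 - a * q ^ n)"
  by (simp add: qpoch_def)

lemma qpoch_self_Suc: "qpoch q q (Suc n) = qpoch q q n * (1 - q ^ Suc n)"
  by (simp add: qpoch_Suc)

lemma qpoch_self_nonzero:
  fixes q :: "'a::field"
  assumes "\<forall>n>0. q ^ n \<noteq> 1"
  shows "qpoch q q n \<noteq> 0"
proof (induction n)
  case (Suc n)
  have "q ^ Suc n \<noteq> 1" using assms by blast
  with Suc show ?case by (simp add: qpoch_self_Suc del: power_Suc)
qed simp

lemma gauss_binom_add:
  "gauss_binom p (m + r) r = qpoch p p (m + r) / (qpoch p p r * qpoch p p m)"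
  by (simp add: gauss_binom_def)

text \<open>
  After clearing denominators this is
  \<open>1 - p^(m+r+2) = (1 - p^(r+1)) + p^(r+1) (1 - p^(m+1))\<close>.
\<close>

lemma gauss_binom_pascal:
  fixes p :: "'a::field"
  assumes "\<forall>n>0. p ^ n \<noteq> 1"
  shows "gauss_binom p (Suc m + Suc r) (Suc r)
    = gauss_binom p (Suc m + r) r + p ^ Suc r * gauss_binom p (m + Suc r) (Suc r)"
proof -
  note nz = qpoch_self_nonzero[OF assms]
  have ne: "1 - p ^ Suc r \<noteq> 0" "1 - p ^ Suc m \<noteq> 0" using assms by (metis eq_iff_diff_eq_0 zero_less_Suc)+
  let ?a = "qpoch p p r" and ?b = "qpoch p p m" and ?c = "qpoch p p (Suc (m + r))"
  have "gauss_binom p (Suc m + Suc r) (Suc r)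
      = ?c * (1 - p ^ Suc (Suc (m + r))) / (?a * (1 - p ^ Suc r) * (?b * (1 - p ^ Suc m)))"
    unfolding gauss_binom_add qpoch_self_Suc[symmetric] by simp
  moreover have "gauss_binom p (Suc m + r) r = ?c / (?a * (?b * (1 - p ^ Suc m)))"
    unfolding gauss_binom_add qpoch_self_Suc[symmetric] by simp
  moreover have "gauss_binom p (m + Suc r) (Suc r) = ?c / (?a * (1 - p ^ Suc r) * ?b)"
    unfolding gauss_binom_add qpoch_self_Suc[symmetric] by simp
  moreover have "p ^ Suc (Suc (m + r)) = p ^ Suc r * p ^ Suc m"
    unfolding power_add[symmetric] by (simp add: add.commute)
  moreover have partial_fractions: "c * (1 - x * y) / (a * (1 - x) * (b * (1 - y)))
      = c / (a * (b * (1 - y))) + x * (c / (a * (1 - x) * b))"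
    if "a \<noteq> 0" "b \<noteq> 0" "1 - x \<noteq> 0" "1 - y \<noteq> 0" for a b c x y :: 'a
    using that by (simp add: divide_simps) (simp add: algebra_simps)
  ultimately show ?thesis by (simp only: partial_fractions[OF nz nz ne])
qed

lemma sum_qpoch_self_inverse:
  fixes q :: "'a::field"
  assumes "\<forall>n>0. q ^ n \<noteq> 1"
  shows "(\<Sum>m\<le>n. q ^ m / qpoch q q m) = 1 / qpoch q q n"
proof (induction n)
  case (Suc n)
  have "1 - q ^ Suc n \<noteq> 0" using assms by (metis eq_iff_diff_eq_0 zero_less_Suc)
  with qpoch_self_nonzero[OF assms, of n] show ?case
    unfolding sum.atMost_Suc Suc.IH qpoch_self_Suc by (simp add: divide_simps del: power_Suc)
qed simp

text \<open>
  The Gaussian polynomials with base \<open>p = q\<^sup>-\<^sup>1\<close> are the complete homogeneous symmetric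
  polynomials in \<open>1, p, \<dots>, p^r\<close>, and \<open>q^j / (q;q)\<^sub>j\<close> is the one in \<open>q, q\<^sup>2, \<dots>\<close>.
  The convolution is therefore the complete homogeneous symmetric polynomial in
  \<open>p^r, p^(r-1), \<dots>\<close>, which is \<open>p^(rn)\<close> times the one in \<open>1, q, q\<^sup>2, \<dots>\<close>. The proof adjoins
  the variables \<open>1, p, p\<^sup>2, \<dots>\<close> one at a time.
\<close>

lemma sum_gauss_binom_inverse:
  fixes q :: "'a::field"
  assumes q0: "q \<noteq> 0" and q1: "\<forall>n>0. q ^ n \<noteq> 1"
  shows "(\<Sum>m\<le>n. gauss_binom (inverse q) (m + r) r * (q ^ (n - m) / qpoch q q (n - m)))
    = inverse q ^ (r * n) / qpoch q q n"
proof -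
  define p where "p = inverse q"
  have p1: "\<forall>n>0. p ^ n \<noteq> 1"
    using q1 by (simp add: p_def power_inverse)
  note nz = qpoch_self_nonzero[OF p1]
  note nzq = qpoch_self_nonzero[OF q1]
  have G0: "gauss_binom p (m + 0) 0 = 1" for m
    using nz by (simp add: gauss_binom_def)
  have Gm0: "gauss_binom p (0 + r) r = 1" for r
    using nz by (simp add: gauss_binom_def)
  define T where "T = (\<lambda>r n. \<Sum>m\<le>n. gauss_binom p (m + r) r * (q ^ (n - m) / qpoch q q (n - m)))"
  \<comment> \<open>Adjoining the variable \<open>p^(r+1)\<close>: monomials without it and with it.\<close>
  have rec: "T (Suc r) (Suc n) = T r (Suc n) + p ^ Suc r * T (Suc r) n" for r n
  proof -
    let ?e = "\<lambda>m. q ^ (n - m) / qpoch q q (n - m)"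
    have "T (Suc r) (Suc n) = q ^ Suc n / qpoch q q (Suc n)
        + (\<Sum>m\<le>n. gauss_binom p (Suc m + Suc r) (Suc r) * ?e m)"
      unfolding T_def sum.atMost_Suc_shift Gm0 by simp
    also have "(\<Sum>m\<le>n. gauss_binom p (Suc m + Suc r) (Suc r) * ?e m)
        = (\<Sum>m\<le>n. gauss_binom p (Suc m + r) r * ?e m)
          + p ^ Suc r * T (Suc r) n"
      unfolding gauss_binom_pascal[OF p1] T_def
      by (simp only: distrib_right sum.distrib sum_distrib_left mult.assoc)
    also have "q ^ Suc n / qpoch q q (Suc n) + ((\<Sum>m\<le>n. gauss_binom p (Suc m + r) r * ?e m)
          + p ^ Suc r * T (Suc r) n) = T r (Suc n) + p ^ Suc r * T (Suc r) n"
      unfolding T_def sum.atMost_Suc_shift Gm0 by simp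
    finally show ?thesis .
  qed
  have "T r n = p ^ (r * n) / qpoch q q n"
  proof (induction r arbitrary: n)
    case 0
    have "T 0 n = (\<Sum>m\<le>n. q ^ (n - m) / qpoch q q (n - m))"
      unfolding T_def G0 by simp
    also have "\<dots> = (\<Sum>m\<le>n. q ^ m / qpoch q q m)"
      by (rule sum.reindex_bij_witness[of _ "\<lambda>m. n - m" "\<lambda>m. n - m"]) auto
    finally show ?case using sum_qpoch_self_inverse[OF q1] by simp
  next
    case (Suc r)
    show ?case
    proof (induction n)
      case 0
      then show ?case using Gm0[of "Suc r"] by (simp add: T_def)
    next
      case (Suc n)
      have ne: "1 - q ^ Suc n \<noteq> 0" using q1 by (metis eq_iff_diff_eq_0 zero_less_Suc)
      have pq: "p ^ Suc n * q ^ Suc n = 1"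
        using q0 unfolding power_mult_distrib[symmetric] by (simp add: p_def)
      have "T (Suc r) (Suc n) = p ^ (r * Suc n) / qpoch q q (Suc n)
          + p ^ Suc r * (p ^ (Suc r * n) / qpoch q q n)"
        by (simp only: rec Suc.IH \<open>\<And>n. T r n = p ^ (r * n) / qpoch q q n\<close>)
      also have "p ^ Suc r * (p ^ (Suc r * n) / qpoch q q n) = p ^ (r * Suc n) * p ^ Suc n / qpoch q q n"
        by (simp add: algebra_simps flip: power_add)
      also have "p ^ (r * Suc n) / qpoch q q (Suc n) + p ^ (r * Suc n) * p ^ Suc n / qpoch q q n
          = p ^ (r * Suc n) * (1 + p ^ Suc n * (1 - q ^ Suc n)) / qpoch q q (Suc n)"
        using ne nzq[of n] by (simp add: qpoch_self_Suc divide_simps del: power_Suc mult_Suc_right)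
          (simp add: algebra_simps del: power_Suc mult_Suc_right)
      also have "1 + p ^ Suc n * (1 - q ^ Suc n) = p ^ Suc n"
        using pq by (simp add: algebra_simps del: power_Suc)
      also have "p ^ (r * Suc n) * p ^ Suc n = p ^ (Suc r * Suc n)"
        by (simp add: algebra_simps flip: power_add)
      finally show ?case .
    qed
  qed
  then show ?thesis by (simp add: T_def p_def)
qed

lemma fps_one_minus_X_cancel:
  assumes "(1 - fps_X) * f = (1 - fps_X) * (g :: 'a::field fps)"
  shows "f = g"
proof -
  have "fps_nth (1 - fps_X :: 'a fps) 0 \<noteq> 0" by simp
  then have "(1 - fps_X :: 'a fps) \<noteq> 0" by fastforce
  with assms show ?thesis by simp
qed

text \<open>
  Here \<open>v = (t\<^sup>2;q\<^sup>2)\<^sub>\<infinity>\<close> and \<open>e = 1 / (t;q)\<^sub>\<infinity>\<close> as power series in \<open>t\<close>, given by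
  their coefficients. With the dilation \<open>D\<close> that replaces \<open>t\<close> by \<open>qt\<close> they satisfy
  \<open>v = (1 - t\<^sup>2) D v\<close> and \<open>(1 - t) e = D e\<close>. Hence \<open>v e = (1 + t) D (v e)\<close>, which is the
  functional equation of \<open>(-t;q)\<^sub>\<infinity>\<close> and determines the coefficients of \<open>v e\<close> recursively.
\<close>

lemma sum_even_qpoch_alternating:
  fixes q :: "'a::field"
  assumes q1: "\<forall>n>0. q ^ n \<noteq> 1"
  shows "(\<Sum>k\<le>N div 2. (-1) ^ k * q ^ (k * (k - 1)) / (qpoch (q\<^sup>2) (q\<^sup>2) k * qpoch q q (N - 2 * k)))
    = q ^ (N choose 2) / qpoch q q N"
proof -
  define D where "D = (\<lambda>f :: 'a fps. f oo (fps_const q * fps_X))"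
  have D_nth: "fps_nth (D f) n = q ^ n * fps_nth f n" for f n by (simp add: D_def)
  have D_mult: "D (f * g) = D f * D g" for f g
    unfolding D_def by (rule fps_compose_mult_distrib) simp
  have q2: "\<forall>n>0. (q\<^sup>2) ^ n \<noteq> 1"
    using q1 by (simp flip: power_mult)
  note nz = qpoch_self_nonzero[OF q1]
  note nz2 = qpoch_self_nonzero[OF q2]
  define c where "c = (\<lambda>k. (-1) ^ k * q ^ (k * (k - 1)) / qpoch (q\<^sup>2) (q\<^sup>2) k)"
  define e where "e = Abs_fps (\<lambda>n. 1 / qpoch q q n)"
  define v where "v = Abs_fps (\<lambda>n. if even n then c (n div 2) else 0)"
  have e: "(1 - fps_X) * e = D e"
  proof (rule fps_ext)
    fix n show "fps_nth ((1 - fps_X) * e) n = fps_nth (D e) n"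
    proof (cases n)
      case (Suc m)
      have ne: "1 - q ^ Suc m \<noteq> 0" using q1 by (metis eq_iff_diff_eq_0 zero_less_Suc)
      have "1 / (x * (1 - y)) - 1 / x = y * (1 / (x * (1 - y)))"
        if "x \<noteq> 0" "1 - y \<noteq> 0" for x y :: 'a
        using that by (simp add: divide_simps)
      from this[OF nz[of m] ne] show ?thesis
        by (simp add: Suc D_nth e_def left_diff_distrib qpoch_self_Suc del: power_Suc)
    qed (simp add: D_nth e_def left_diff_distrib)
  qed
  have c_Suc: "c (Suc k) * (1 - q ^ (2 * k + 2)) = - (q ^ (2 * k) * c k)" for k
  proof -
    have ne: "1 - (q\<^sup>2) ^ Suc k \<noteq> 0" using q2 by (metis eq_iff_diff_eq_0 zero_less_Suc)
    have pq: "q ^ (2 * k + 2) = (q\<^sup>2) ^ Suc k" unfolding power_mult[symmetric] by simp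
    have "Suc k * (Suc k - 1) = k * (k - 1) + 2 * k" by (cases k) auto
    then have "q ^ (Suc k * (Suc k - 1)) = q ^ (k * (k - 1)) * q ^ (2 * k)"
      by (simp only: power_add)
    then have "c (Suc k) = - (c k * q ^ (2 * k)) / (1 - (q\<^sup>2) ^ Suc k)"
      unfolding c_def qpoch_self_Suc power_Suc[of "-1"] 
      by (simp only: divide_divide_eq_left times_divide_eq_left mult_minus1 minus_mult_left[symmetric] minus_divide_left[symmetric] mult_1_left mult.assoc)
    then show ?thesis unfolding pq nonzero_eq_divide_eq[OF ne] by (simp only: mult.commute)
  qed
  have v: "v = (1 - fps_X\<^sup>2) * D v"
  proof (rule fps_ext)
    fix n show "fps_nth v n = fps_nth ((1 - fps_X\<^sup>2) * D v) n"
    proof (cases "even n \<and> n > 0")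
      case True
      then obtain j where "n = 2 * j" "j > 0" by (auto elim!: evenE)
      then obtain k where n: "n = 2 * Suc k" by (metis not0_implies_Suc less_irrefl)
      have "fps_nth ((1 - fps_X\<^sup>2) * D v) n = q ^ (2 * k + 2) * c (Suc k) - q ^ (2 * k) * c k"
        by (simp add: n v_def D_nth left_diff_distrib fps_X_power_mult_nth del: power_Suc)
      also have "\<dots> = c (Suc k)"
      proof -
        have "y * x - z = x" if "x * (1 - y) = - z" for x y z :: 'a
          using that by algebra
        from this[OF c_Suc] show ?thesis .
      qed
      finally show ?thesis by (simp add: n v_def)
    qed (auto simp: v_def D_nth left_diff_distrib fps_X_power_mult_nth)
  qed
  have "(1 - fps_X) * (v * e) = v * D e" by (simp add: e[symmetric] mult_ac)
  also have "\<dots> = (1 - fps_X\<^sup>2) * D (v * e)" by (subst v) (simp add: D_mult mult_ac)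
  also have "\<dots> = (1 - fps_X) * ((1 + fps_X) * D (v * e))"
    by algebra
  finally have f: "v * e = (1 + fps_X) * D (v * e)" by (rule fps_one_minus_X_cancel)
  have "fps_nth (v * e) N = q ^ (N choose 2) / qpoch q q N" for N
  proof (induction N)
    case 0
    then show ?case by (simp add: v_def e_def c_def binomial_eq_0)
  next
    case (Suc N)
    have ne: "1 - q ^ Suc N \<noteq> 0" using q1 by (metis eq_iff_diff_eq_0 zero_less_Suc)
    have "fps_nth (v * e) (Suc N) = q ^ Suc N * fps_nth (v * e) (Suc N) + q ^ N * fps_nth (v * e) N"
      by (subst f) (simp add: distrib_right D_nth del: power_Suc)
    then have "(1 - q ^ Suc N) * fps_nth (v * e) (Suc N) = q ^ N * q ^ (N choose 2) / qpoch q q N"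
      using Suc by (simp add: algebra_simps del: power_Suc)
    also have "q ^ N * q ^ (N choose 2) = q ^ (Suc N choose 2)"
      by (simp add: numeral_2_eq_2 flip: power_add)
    finally have *: "(1 - q ^ Suc N) * fps_nth (v * e) (Suc N) = q ^ (Suc N choose 2) / qpoch q q N" .
    have "z = a / (x * (1 - y))" if "(1 - y) * z = a / x" "1 - y \<noteq> 0" for a x y z :: 'a
    proof -
      have "z = (a / x) / (1 - y)"
        using that by (metis nonzero_mult_div_cancel_left)
      then show ?thesis by simp
    qed
    from this[OF * ne] show ?case by (simp only: qpoch_self_Suc)
  qed
  moreover have "fps_nth (v * e) N = (\<Sum>k\<le>N div 2. c k / qpoch q q (N - 2 * k))"
  proof -
    have "fps_nth (v * e) N = (\<Sum>i\<in>{0..N}. fps_nth v i / qpoch q q (N - i))"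
      by (simp add: fps_mult_nth e_def)
    also have "\<dots> = (\<Sum>i\<in>(\<lambda>k. 2 * k) ` {..N div 2}. fps_nth v i / qpoch q q (N - i))"
      by (rule sum.mono_neutral_right) (auto simp: v_def elim!: evenE)
    also have "\<dots> = (\<Sum>k\<le>N div 2. c k / qpoch q q (N - 2 * k))"
      by (subst sum.reindex) (auto simp: v_def inj_on_def)
    finally show ?thesis .
  qed
  ultimately show ?thesis by (simp add: c_def)
qed

section \<open>Orders of vanishing\<close>

lemma two_mult_choose_two: "2 * int (n choose 2) = int n * (int n - 1)"
  by (induction n) (simp_all add: numeral_2_eq_2 algebra_simps)

lemma le_Suc_choose_two: "j \<le> Suc j choose 2"
  by (induction j) (auto simp: numeral_2_eq_2)

text \<open>
  Every factor has constant term 1 and no negative powers.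
\<close>

lemma qpoch_subdegree_0:
  fixes a b :: "'a::field fls"
  assumes a: "0 < fls_subdegree a" and b: "0 \<le> fls_subdegree b"
  shows "qpoch a b n \<noteq> 0 \<and> fls_subdegree (qpoch a b n) = 0"
proof (induction n)
  case (Suc n)
  have 0: "fls_nth (a * b ^ n) i = 0" if "i \<le> 0" for i
  proof (cases "b ^ n = 0")
    case False
    have "a \<noteq> 0" using a by auto
    then have "i < fls_subdegree (a * b ^ n)"
      using False that a b by (simp add: fls_subdegree_pow add_pos_nonneg le_less_trans)
    then show ?thesis by (rule fls_eq0_below_subdegree)
  next
    case True
    then show ?thesis by (simp only: mult_zero_right fls_zero_nth)
  qed
  then have "fls_nth (1 - a * b ^ n) 0 = 1" by simp
  moreover from this have "fls_subdegree (1 - a * b ^ n) = 0"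
    using 0 by (intro fls_subdegree_eqI) auto
  ultimately have "1 - a * b ^ n \<noteq> 0 \<and> fls_subdegree (1 - a * b ^ n) = 0" by fastforce
  with Suc show ?case by (simp add: qpoch_Suc)
qed simp

lemma fls_X_power_neq_1: "\<forall>n>0. (fls_X :: 'a::field fls) ^ n \<noteq> 1"
proof (intro allI impI notI)
  fix n :: nat assume "0 < n" and "(fls_X :: 'a fls) ^ n = 1"
  then have "fls_nth (fls_X ^ n :: 'a fls) 0 = fls_nth 1 0" by simp
  with \<open>0 < n\<close> show False by simp
qed

lemma qpoch_fls_X:
  "qpoch (fls_X :: 'a::field fls) fls_X n \<noteq> 0"
  "fls_subdegree (qpoch (fls_X :: 'a::field fls) fls_X n) = 0"
  using qpoch_subdegree_0[of "fls_X :: 'a fls" fls_X n] by auto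

lemma qpoch_fls_X_squared:
  "qpoch ((fls_X :: 'a::field fls)\<^sup>2) (fls_X\<^sup>2) n \<noteq> 0"
  "fls_subdegree (qpoch ((fls_X :: 'a::field fls)\<^sup>2) (fls_X\<^sup>2) n) = 0"
  using qpoch_subdegree_0[of "(fls_X :: 'a fls)\<^sup>2" "fls_X\<^sup>2" n] by auto

text \<open>
  Each factor \<open>1 - q^(-j)\<close> has a pole of order \<open>j\<close>.
\<close>

lemma qpoch_inverse_fls_X:
  fixes p :: "'a::field fls"
  defines "p \<equiv> inverse fls_X"
  shows "qpoch p p n \<noteq> 0 \<and> fls_subdegree (qpoch p p n) = - int (Suc n choose 2)"
proof (induction n)
  case (Suc n)
  let ?x = "fls_X :: 'a fls"
  have "1 - p ^ Suc n = - (p ^ Suc n * (1 - ?x ^ Suc n))"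
    by (simp add: p_def right_diff_distrib flip: power_mult_distrib del: power_Suc fls_inverse_X)
  moreover have "1 - ?x ^ Suc n \<noteq> 0 \<and> fls_subdegree (1 - ?x ^ Suc n) = 0"
    using qpoch_subdegree_0[of "?x ^ Suc n" 1 1] by (simp add: qpoch_def del: power_Suc)
  ultimately have "1 - p ^ Suc n \<noteq> 0 \<and> fls_subdegree (1 - p ^ Suc n) = - int (Suc n)"
    by (simp add: p_def fls_subdegree_pow del: power_Suc)
  with Suc show ?case
    by (simp add: qpoch_self_Suc numeral_2_eq_2 del: power_Suc)
qed (simp add: binomial_eq_0)

text \<open>
  The Gaussian polynomial has degree \<open>mr\<close> in its base and leading coefficient 1, so inverting the
  base produces a pole of that order.
\<close>

lemma gauss_binom_inverse_fls_X:
  fixes p :: "'a::field fls"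
  defines "p \<equiv> inverse fls_X"
  shows "gauss_binom p (m + r) r \<noteq> 0" "fls_subdegree (gauss_binom p (m + r) r) = - int (m * r)"
proof -
  note p = qpoch_inverse_fls_X[where 'a = 'a, folded p_def]
  show "gauss_binom p (m + r) r \<noteq> 0" using p by (simp add: gauss_binom_add)
  have "fls_subdegree (gauss_binom p (m + r) r) =
      - int (Suc (m + r) choose 2) + int (Suc r choose 2) + int (Suc m choose 2)"
    using p by (simp add: gauss_binom_add fls_divide_subdegree)
  moreover have "2 * (- int (Suc (m + r) choose 2) + int (Suc r choose 2) + int (Suc m choose 2)) = 2 * (- int (m * r))"
    unfolding distrib_left mult_minus_right two_mult_choose_two by (simp add: algebra_simps)
  ultimately show "fls_subdegree (gauss_binom p (m + r) r) = - int (m * r)"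
    by (metis mult_cancel_left zero_neq_numeral)
qed

section \<open>Euler's expansion of the infinite product\<close>

text \<open>
  The terms of Euler's expansion of \<open>(-q^(a+1);q)\<^sub>\<infinity>\<close>.
\<close>

definition euler_term :: "nat \<Rightarrow> nat \<Rightarrow> rat fls" where
  "euler_term a j = fls_X ^ ((Suc j choose 2) + a * j) / qpoch fls_X fls_X j"

lemma euler_term_nonzero: "euler_term a j \<noteq> 0"
  by (simp add: euler_term_def qpoch_fls_X)

lemma euler_term_subdegree: "fls_subdegree (euler_term a j) = int (Suc j choose 2) + int (a * j)"
  by (simp add: euler_term_def qpoch_fls_X fls_divide_subdegree)

definition euler_sum :: "nat \<Rightarrow> rat fls" where
  "euler_sum a = infsum (euler_term a) UNIV"

lemma euler_sum_has_sum: "(euler_term a has_sum euler_sum a) UNIV"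
proof -
  have "euler_term a summable_on UNIV"
  proof (rule summable_on_flsI[where d = "\<lambda>j. j"])
    fix j i assume "i < int j"
    also have "int j \<le> fls_subdegree (euler_term a j)"
      using le_Suc_choose_two[of j] by (simp add: euler_term_subdegree add_increasing2)
    finally show "fls_nth (euler_term a j) i = 0" by (rule fls_eq0_below_subdegree)
  qed simp
  then show ?thesis unfolding euler_sum_def by (rule has_sum_infsum)
qed

text \<open>
  Euler's series tends to 1 as \<open>a\<close> grows, which anchors the telescoping product below.
\<close>

lemma euler_sum_near_1: "i < int a \<Longrightarrow> fls_nth (1 - euler_sum a) i = 0"
proof -
  assume i: "i < int a"
  have "((\<lambda>j. if j = 0 then 1 else 0) has_sum 1) (UNIV :: nat set)"
    by (rule has_sum_finite_neutralI[of "{0}"]) auto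
  from has_sum_add[OF this has_sum_fls_mult_left[OF euler_sum_has_sum[of a], of "-1"]]
  have "((\<lambda>j. (if j = 0 then 1 else 0) - euler_term a j) has_sum 1 - euler_sum a) UNIV"
    by simp
  then show ?thesis
  proof (rule has_sum_fls_nth_eq0)
    fix j :: nat
    show "fls_nth ((if j = 0 then 1 else 0) - euler_term a j) i = 0"
    proof (cases "j = 0")
      case False
      have "a * 1 \<le> a * j" using False by (intro mult_le_mono2) simp
      with i have "i < int (a * j)" by linarith
      then have "i < fls_subdegree (euler_term a j)" by (simp add: euler_term_subdegree)
      then show ?thesis using False by (simp add: fls_eq0_below_subdegree)
    qed (simp add: euler_term_def binomial_eq_0)
  qed
qed

text \<open>
  Splitting \<open>1 = q^j + (1 - q^j)\<close> in the \<open>j\<close>-th term gives a term of the series for \<open>a + 1\<close> plus,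
  after cancelling \<open>1 - q^j\<close>, the preceding term of that series times \<open>q^(a+1)\<close>.
\<close>

lemma euler_sum_rec: "euler_sum a = (1 + fls_X ^ Suc a) * euler_sum (Suc a)"
proof -
  define g where "g = (\<lambda>j. case j of 0 \<Rightarrow> 0 | Suc i \<Rightarrow> fls_X ^ Suc a * euler_term (Suc a) i)"
  have "((g \<circ> Suc) has_sum fls_X ^ Suc a * euler_sum (Suc a)) UNIV"
    using has_sum_fls_mult_left[OF euler_sum_has_sum[of "Suc a"], of "fls_X ^ Suc a"]
    by (simp add: g_def o_def)
  then have "(g has_sum fls_X ^ Suc a * euler_sum (Suc a)) (range Suc)"
    by (subst has_sum_reindex) auto
  also have "?this \<longleftrightarrow> (g has_sum fls_X ^ Suc a * euler_sum (Suc a)) UNIV"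
    by (rule has_sum_cong_neutral) (auto simp: g_def split: nat.splits)
  finally have "((\<lambda>j. euler_term (Suc a) j + g j) has_sum
      euler_sum (Suc a) + fls_X ^ Suc a * euler_sum (Suc a)) UNIV"
    by (rule has_sum_add[OF euler_sum_has_sum])
  also have "(\<lambda>j. euler_term (Suc a) j + g j) = euler_term a"
  proof
    fix j
    show "euler_term (Suc a) j + g j = euler_term a j"
    proof (cases j)
      case (Suc i)
      let ?x = "fls_X :: rat fls"
      have ne: "1 - ?x ^ Suc i \<noteq> 0" using fls_X_power_neq_1[where 'a = rat]
        by (metis eq_iff_diff_eq_0 zero_less_Suc)
      define A where "A = ?x ^ ((Suc j choose 2) + a * j)"
      have 1: "?x ^ ((Suc j choose 2) + Suc a * j) = A * ?x ^ Suc i"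
        unfolding A_def Suc power_add[symmetric] by (simp add: algebra_simps)
      have 2: "?x ^ Suc a * ?x ^ ((Suc i choose 2) + Suc a * i) = A"
        unfolding A_def Suc power_add[symmetric] by (simp add: algebra_simps numeral_2_eq_2)
      have alg: "A * y / (z * (1 - y)) + A / z = A / (z * (1 - y))" if "z \<noteq> 0" "1 - y \<noteq> 0" for y z
      proof -
        have "A / z = A * (1 - y) / (z * (1 - y))" using that by simp
        then have "A * y / (z * (1 - y)) + A / z = (A * y + A * (1 - y)) / (z * (1 - y))"
          by (simp only: add_divide_distrib)
        also have "A * y + A * (1 - y) = A" by (simp add: right_diff_distrib)
        finally show ?thesis .
      qed
      have "euler_term (Suc a) j = A * ?x ^ Suc i / (qpoch ?x ?x i * (1 - ?x ^ Suc i))"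
        unfolding euler_term_def 1 unfolding Suc qpoch_self_Suc ..
      moreover have "g j = A / qpoch ?x ?x i"
        unfolding 2[symmetric] by (simp add: g_def Suc euler_term_def del: power_Suc)
      moreover have "euler_term a j = A / (qpoch ?x ?x i * (1 - ?x ^ Suc i))"
        unfolding euler_term_def A_def unfolding Suc qpoch_self_Suc ..
      ultimately show ?thesis by (simp only: alg[OF qpoch_fls_X(1) ne])
    qed (simp add: g_def euler_term_def)
  qed
  finally have "(euler_term a has_sum (1 + fls_X ^ Suc a) * euler_sum (Suc a)) UNIV"
    by (simp add: distrib_right del: power_Suc)
  with euler_sum_has_sum show ?thesis by (rule has_sum_unique)
qed

text \<open>
  Iterating the recurrence peels off the factors of the product; the series that is left over tends
  to 1.
\<close>

lemma qpoch_inf_eq_euler_sum: "qpoch_inf (- (fls_X ^ Suc a)) fls_X = euler_sum a"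
proof -
  let ?x = "fls_X :: rat fls"
  let ?P = "\<lambda>n. qpoch (- (?x ^ Suc a)) ?x n"
  have prod: "?P n * euler_sum (a + n) = euler_sum a" for n
  proof (induction n)
    case (Suc n)
    have "?P (Suc n) * euler_sum (a + Suc n) = ?P n * ((1 + ?x ^ Suc (a + n)) * euler_sum (Suc (a + n)))"
      by (simp add: qpoch_Suc power_add mult_ac)
    then show ?case using Suc by (simp only: euler_sum_rec[symmetric])
  qed simp
  have "?P \<longlonglongrightarrow> euler_sum a"
    unfolding tendsto_fls_iff
  proof
    fix N
    have "fls_nth (?P n) i = fls_nth (euler_sum a) i" if "n \<ge> N" "i < int N" for n i
    proof -
      have "fls_subdegree (?P n) = 0"
        using qpoch_subdegree_0[of "- (?x ^ Suc a)" ?x n] by (simp del: power_Suc)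
      then have "fls_nth (?P n * (1 - euler_sum (a + n))) i = 0"
        using that by (intro fls_nth_mult_eq0[where N = "int (a + n)"] euler_sum_near_1) auto
      then show ?thesis unfolding right_diff_distrib prod by simp
    qed
    then show "\<forall>\<^sub>F n in sequentially. \<forall>i<int N. fls_nth (?P n) i = fls_nth (euler_sum a) i"
      unfolding eventually_sequentially by blast
  qed
  then show ?thesis unfolding qpoch_inf_def by (rule limI)
qed

section \<open>Partitions without consecutive parts\<close>

text \<open>
  The largest \<open>k\<close> such that \<open>k\<close> and \<open>k + 1\<close> are both parts starts a raft.
\<close>

lemma rafts_empty_iff: "rafts xs = {} \<longleftrightarrow> (\<forall>k. k \<in> set xs \<longrightarrow> k + 1 \<notin> set xs)"
proof
  assume r: "rafts xs = {}"
  show "\<forall>k. k \<in> set xs \<longrightarrow> k + 1 \<notin> set xs"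
  proof (rule ccontr)
    assume "\<not> ?thesis"
    then have ne: "{k \<in> set xs. k + 1 \<in> set xs} \<noteq> {}" by blast
    define k where "k = Max {k \<in> set xs. k + 1 \<in> set xs}"
    have k: "k \<in> {k \<in> set xs. k + 1 \<in> set xs}" unfolding k_def by (rule Max_in) (use ne in auto)
    have "k + 1 \<notin> {k \<in> set xs. k + 1 \<in> set xs}"
    proof
      assume "k + 1 \<in> {k \<in> set xs. k + 1 \<in> set xs}"
      then have "k + 1 \<le> k" unfolding k_def by (intro Max_ge) auto
      then show False by simp
    qed
    with k have "(k, k + 1) \<in> rafts xs" by (auto simp: rafts_def)
    with r show False by simp
  qed
qed (auto simp: rafts_def)

text \<open>
  The lower bound \<open>s\<close> on the parts makes the recursion on the smallest part possible.
\<close>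

definition gap2_lists :: "nat \<Rightarrow> nat \<Rightarrow> nat \<Rightarrow> nat list set" where
  "gap2_lists N s n = {xs. length xs = N \<and> sorted_wrt (\<lambda>x y. x + 2 \<le> y) xs \<and>
     (\<forall>x\<in>set xs. s < x) \<and> sum_list xs = n}"

lemma length_le_sum_list:
  fixes xs :: "nat list"
  shows "(\<And>x. x \<in> set xs \<Longrightarrow> 0 < x) \<Longrightarrow> length xs \<le> sum_list xs"
  by (induction xs) (force simp: Suc_le_eq)+

lemma finite_gap2_lists: "finite (gap2_lists N s n)"
proof (rule finite_subset)
  show "gap2_lists N s n \<subseteq> {xs. set xs \<subseteq> {..n} \<and> length xs = N}"
    by (auto simp: gap2_lists_def member_le_sum_list)
qed (simp add: finite_lists_length_eq)

lemma raftless_partitions_eq: "raftless_partitions n = (\<Union>N\<le>n. gap2_lists N 0 n)"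
proof (rule set_eqI)
  fix xs
  have "xs \<in> raftless_partitions n \<longleftrightarrow>
      sorted_wrt (\<lambda>x y. x + 2 \<le> y) xs \<and> (\<forall>x\<in>set xs. 0 < x) \<and> sum_list xs = n"
  proof (safe)
    assume xs: "xs \<in> raftless_partitions n"
    then have *: "\<forall>k. k \<in> set xs \<longrightarrow> k + 1 \<notin> set xs" and "sorted_wrt (<) xs"
      by (auto simp: raftless_partitions_def distinct_partitions_def rafts_empty_iff)
    from this(2) show "sorted_wrt (\<lambda>x y. x + 2 \<le> y) xs"
    proof (rule sorted_wrt_mono_rel[rotated])
      fix x y assume "x \<in> set xs" "y \<in> set xs" "x < y"
      moreover from this * have "y \<noteq> x + 1" by blast
      ultimately show "x + 2 \<le> y" by simp
    qed
  next
    assume *: "sorted_wrt (\<lambda>x y. x + 2 \<le> y) xs"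
    have "k + 1 \<notin> set xs" if "k \<in> set xs" for k
      using * that by (induction xs) force+
    moreover have "sorted_wrt (<) xs"
      using * by (rule sorted_wrt_mono_rel[rotated]) auto
    moreover assume "\<forall>x\<in>set xs. 0 < x" "n = sum_list xs"
    ultimately show "xs \<in> raftless_partitions (sum_list xs)"
      by (simp add: raftless_partitions_def distinct_partitions_def rafts_empty_iff)
  qed (auto simp: raftless_partitions_def distinct_partitions_def)
  then show "xs \<in> raftless_partitions n \<longleftrightarrow> xs \<in> (\<Union>N\<le>n. gap2_lists N 0 n)"
    using length_le_sum_list[of xs] by (auto simp: gap2_lists_def)
qed

lemma card_raftless_partitions:
  "card (raftless_partitions n) = (\<Sum>N\<le>n. card (gap2_lists N 0 n))"
  unfolding raftless_partitions_eq
  by (rule card_UN_disjoint) (auto simp: finite_gap2_lists, auto simp: gap2_lists_def)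

lemma gap2_lists_shift:
  "gap2_lists N (Suc s) n = (if n < N then {} else map Suc ` gap2_lists N s (n - N))"
proof -
  have sum_Suc: "sum_list (map Suc ys) = sum_list ys + length ys" for ys by (induction ys) auto
  have "xs \<in> map Suc ` gap2_lists N s (n - N) \<and> N \<le> n" if xs: "xs \<in> gap2_lists N (Suc s) n" for xs
  proof -
    have *: "map Suc (map (\<lambda>x. x - 1) xs) = xs"
      using xs by (auto simp: gap2_lists_def o_def intro!: map_idI)
    have "sum_list xs = sum_list (map (\<lambda>x. x - 1) xs) + length xs"
      using sum_Suc[of "map (\<lambda>x. x - 1) xs"] unfolding * by simp
    moreover have "sorted_wrt (\<lambda>x y. x + 2 \<le> y) (map (\<lambda>x. x - 1) xs)"
      unfolding sorted_wrt_map
      by (rule sorted_wrt_mono_rel[of xs "\<lambda>x y. x + 2 \<le> y"]) (use xs in \<open>auto simp: gap2_lists_def\<close>)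
    ultimately have "map (\<lambda>x. x - 1) xs \<in> gap2_lists N s (n - N)" "N \<le> n"
      using xs by (auto simp: gap2_lists_def)
    then show ?thesis using * by (metis imageI)
  qed
  moreover have "map Suc ys \<in> gap2_lists N (Suc s) n" if "ys \<in> gap2_lists N s (n - N)" "N \<le> n" for ys
    using that by (auto simp: gap2_lists_def sorted_wrt_map sum_Suc)
  ultimately show ?thesis by (auto simp: not_less) force
qed

text \<open>
  Either \<open>s + 1\<close> is not a part, or it is the smallest part and all others exceed \<open>s + 2\<close>.
\<close>

lemma gap2_lists_Suc:
  "gap2_lists (Suc N) s n = gap2_lists (Suc N) (Suc s) n \<union>
     (if n < Suc s then {} else (#) (Suc s) ` gap2_lists N (Suc (Suc s)) (n - Suc s))"
proof (rule set_eqI)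
  fix xs
  show "xs \<in> gap2_lists (Suc N) s n \<longleftrightarrow> xs \<in> gap2_lists (Suc N) (Suc s) n \<union>
     (if n < Suc s then {} else (#) (Suc s) ` gap2_lists N (Suc (Suc s)) (n - Suc s))"
  proof (cases xs)
    case (Cons y ys)
    have *: "xs \<in> gap2_lists (Suc N) s n \<longleftrightarrow> length ys = N \<and> s < y \<and> (\<forall>x\<in>set ys. y + 2 \<le> x)
        \<and> sorted_wrt (\<lambda>x y. x + 2 \<le> y) ys \<and> y + sum_list ys = n" for s
      unfolding Cons gap2_lists_def by fastforce
    have "xs \<in> (if n < Suc s then {} else (#) (Suc s) ` gap2_lists N (Suc (Suc s)) (n - Suc s)) \<longleftrightarrow>
        y = Suc s \<and> Suc s \<le> n \<and> ys \<in> gap2_lists N (Suc (Suc s)) (n - Suc s)"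
      by (auto simp: Cons)
    note tail = this
    show ?thesis
    proof (cases "y = Suc s")
      case True
      have "(\<forall>x\<in>set ys. y + 2 \<le> x) \<longleftrightarrow> (\<forall>x\<in>set ys. Suc (Suc s) < x)"
        using True by (intro ball_cong) auto
      moreover have "y + sum_list ys = n \<longleftrightarrow> Suc s \<le> n \<and> sum_list ys = n - Suc s"
        using True by linarith
      ultimately show ?thesis unfolding Un_iff * tail unfolding gap2_lists_def mem_Collect_eq
        using True by blast
    next
      case False
      then have "s < y \<longleftrightarrow> Suc s < y" by linarith
      with False show ?thesis unfolding Un_iff * tail by blast
    qed
  qed (auto simp: gap2_lists_def)
qed

definition gap2_fps :: "nat \<Rightarrow> nat \<Rightarrow> rat fps" where
  "gap2_fps N s = Abs_fps (\<lambda>n. of_nat (card (gap2_lists N s n)))"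

lemma gap2_fps_shift: "gap2_fps N (Suc s) = fps_X ^ N * gap2_fps N s"
proof (rule fps_ext)
  fix n
  have "inj_on (map Suc) X" for X by (auto simp: inj_on_def)
  then show "fps_nth (gap2_fps N (Suc s)) n = fps_nth (fps_X ^ N * gap2_fps N s) n"
    by (simp add: gap2_fps_def gap2_lists_shift fps_X_power_mult_nth card_image)
qed

lemma gap2_fps_Suc:
  "gap2_fps (Suc N) s = gap2_fps (Suc N) (Suc s) + fps_X ^ Suc s * gap2_fps N (Suc (Suc s))"
proof (rule fps_ext)
  fix n
  let ?B = "if n < Suc s then {} else (#) (Suc s) ` gap2_lists N (Suc (Suc s)) (n - Suc s)"
  have "card (gap2_lists (Suc N) s n) = card (gap2_lists (Suc N) (Suc s) n) + card ?B"
    unfolding gap2_lists_Suc[of N s n]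
    by (rule card_Un_disjoint) (auto simp: finite_gap2_lists, auto simp: gap2_lists_def)
  moreover have "card ?B = (if n < Suc s then 0 else card (gap2_lists N (Suc (Suc s)) (n - Suc s)))"
    by (simp add: card_image)
  ultimately show "fps_nth (gap2_fps (Suc N) s) n =
      fps_nth (gap2_fps (Suc N) (Suc s) + fps_X ^ Suc s * gap2_fps N (Suc (Suc s))) n"
    by (simp add: gap2_fps_def fps_X_power_mult_nth del: power_Suc)
qed

text \<open>
  The smallest-part recursion relates the bounds 0, 1 and 2, and subtracting 1 or 2 from every part
  brings them all back to the bound 0. The result is
  \<open>(1 - q^(N+1)) G(N + 1) = q^(2N+1) G(N)\<close>, and the exponents \<open>2N + 1\<close> add up to squares.
\<close>

lemma gap2_fps_closed_form:
  "gap2_fps N 0 * qpoch fps_X fps_X N = fps_X ^ (N ^ 2)"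
proof (induction N)
  case 0
  have "gap2_lists 0 0 n = (if n = 0 then {[]} else {})" for n
    by (auto simp: gap2_lists_def)
  then have "gap2_fps 0 0 = 1" by (intro fps_ext) (simp add: gap2_fps_def)
  then show ?case by (simp add: qpoch_def)
next
  case (Suc N)
  have "gap2_fps (Suc N) 0 = fps_X ^ Suc N * gap2_fps (Suc N) 0
      + fps_X ^ Suc 0 * (fps_X ^ N * (fps_X ^ N * gap2_fps N 0))"
    using gap2_fps_Suc[of N 0] unfolding gap2_fps_shift .
  also have "fps_X ^ Suc 0 * (fps_X ^ N * (fps_X ^ N * gap2_fps N 0)) = fps_X ^ (2 * N + 1) * gap2_fps N 0"
    unfolding mult.assoc[symmetric] power_add[symmetric] by (simp add: mult_2)
  finally have *: "gap2_fps (Suc N) 0 * (1 - fps_X ^ Suc N) = fps_X ^ (2 * N + 1) * gap2_fps N 0"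
    unfolding right_diff_distrib by (simp only: mult.commute mult_1_left diff_eq_eq add.commute)
  have "gap2_fps (Suc N) 0 * qpoch fps_X fps_X (Suc N)
      = gap2_fps (Suc N) 0 * (1 - fps_X ^ Suc N) * qpoch fps_X fps_X N"
    by (simp add: qpoch_def mult_ac)
  also have "\<dots> = fps_X ^ (2 * N + 1) * (gap2_fps N 0 * qpoch fps_X fps_X N)"
    unfolding * by (rule mult.assoc)
  also have "\<dots> = fps_X ^ ((Suc N)\<^sup>2)"
    unfolding Suc power_add[symmetric] by (simp add: power2_eq_square)
  finally show ?case .
qed

section \<open>Designated rafts and the generating function\<close>

text \<open>
  The generating function of partitions into \<open>2k + n\<close> distinct parts with \<open>k\<close> designated rafts.
\<close>

definition raft_coeff :: "nat \<Rightarrow> nat \<Rightarrow> rat fls" where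
  "raft_coeff k n = fls_X ^ (3 * k\<^sup>2 + 2 * k * n + (Suc n choose 2))
     / (qpoch (fls_X\<^sup>2) (fls_X\<^sup>2) k * qpoch fls_X fls_X n)"

text \<open>
  The summands of the series after Euler's expansion of the infinite product, without the sign.
\<close>

definition raft_term :: "nat \<Rightarrow> nat \<Rightarrow> nat \<Rightarrow> rat fls" where
  "raft_term k m j = fls_X powi (int ((3 * k + m) choose 2) - 3 * int (k choose 2))
     * gauss_binom (inverse fls_X) (m + k - 1) (k - 1)
     * (euler_term (3 * k + m) j / qpoch (fls_X\<^sup>2) (fls_X\<^sup>2) k)"

text \<open>
  The pole of the Gaussian polynomial is outweighed by the power of \<open>q\<close> in front of it, so that for
  fixed \<open>k\<close> the terms vanish to order at least \<open>m + j\<close>.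
\<close>

lemma raft_exponent_lower:
  "int (m + j) \<le> int ((3 * Suc r + m) choose 2) - 3 * int (Suc r choose 2) - int (m * r)
     + (int (Suc j choose 2) + int ((3 * Suc r + m) * j))"
proof -
  have "2 * (int ((3 * Suc r + m) choose 2) - 3 * int (Suc r choose 2) - int (m * r))
      = 6 * (int r + 1)\<^sup>2 + 6 * (int r + 1) * int m + int m * (int m - 1) - 2 * int m * int r"
    unfolding right_diff_distrib mult.left_commute[of 2 3] two_mult_choose_two
    by (simp add: algebra_simps power2_eq_square)
  also have "\<dots> = 2 * int m + (6 * (int r + 1)\<^sup>2 + 4 * int m * int r + int m * (int m + 3))"
    by (simp add: algebra_simps)
  also have "\<dots> \<ge> 2 * int m" by simp
  finally have "int m \<le> int ((3 * Suc r + m) choose 2) - 3 * int (Suc r choose 2) - int (m * r)"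
    by (rule mult_left_le_imp_le) simp
  moreover have "int j \<le> int (Suc j choose 2) + int ((3 * Suc r + m) * j)"
    unfolding of_nat_add[symmetric] of_nat_le_iff by (rule trans_le_add1[OF le_Suc_choose_two])
  ultimately show ?thesis unfolding of_nat_add[of m j] by (rule add_mono)
qed

lemma raft_term_subdegree:
  assumes "k \<ge> 1"
  shows "int (m + j) \<le> fls_subdegree (raft_term k m j)"
proof -
  from assms obtain r where k: "k = Suc r" by (cases k) auto
  let ?g = "gauss_binom (inverse (fls_X :: rat fls)) (m + r) r"
  let ?e = "int ((3 * Suc r + m) choose 2) - 3 * int (Suc r choose 2)"
  let ?t = "euler_term (3 * Suc r + m) j / qpoch (fls_X\<^sup>2) (fls_X\<^sup>2) (Suc r)"
  note Q = qpoch_fls_X_squared[where 'a = rat]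
  have mult3: "fls_subdegree (a * b * c) = fls_subdegree a + fls_subdegree b + fls_subdegree c"
    if "a \<noteq> 0" "b \<noteq> 0" "c \<noteq> 0" for a b c :: "rat fls"
    using that by simp
  have X: "fls_subdegree ((fls_X :: rat fls) powi ?e) = ?e" "(fls_X :: rat fls) powi ?e \<noteq> 0"
    by (simp, intro power_int_not_zero disjI1 fls_X_nonzero)
  have g: "fls_subdegree ?g = - int (m * r)" "?g \<noteq> 0"
    by (rule gauss_binom_inverse_fls_X)+
  have t: "fls_subdegree ?t = int (Suc j choose 2) + int ((3 * Suc r + m) * j)" "?t \<noteq> 0"
    using Q by (simp_all add: fls_divide_subdegree euler_term_nonzero euler_term_subdegree del: of_nat_mult)
  have "raft_term k m j = fls_X powi ?e * ?g * ?t"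
    by (simp only: raft_term_def k add_Suc_right diff_Suc_1)
  then have "fls_subdegree (raft_term k m j) = ?e - int (m * r)
      + (int (Suc j choose 2) + int ((3 * Suc r + m) * j))"
    using mult3[OF X(2) g(2) t(2)] unfolding X(1) g(1) t(1) by (simp only: add_uminus_conv_diff)
  with raft_exponent_lower[of m j r] show ?thesis by (simp only:)
qed

text \<open>
  Along \<open>m + j = n\<close> the exponent of \<open>q\<close> depends on \<open>m\<close> only through the summand \<open>j\<close>, because
  \<open>(a + m choose 2) + (j + 1 choose 2) + (a + m) j = (a + n choose 2) + j\<close> for \<open>a = 3k\<close>. So the sum is a
  multiple of the convolution evaluated in \<open>sum_gauss_binom_inverse\<close>.
\<close>

lemma raft_term_diagonal:
  assumes "k \<ge> 1"
  shows "(\<Sum>m\<le>n. raft_term k m (n - m)) = raft_coeff k n"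
proof -
  from assms obtain r where k: "k = Suc r" by (cases k) auto
  let ?x = "fls_X :: rat fls"
  let ?P = "qpoch (?x\<^sup>2) (?x\<^sup>2) k"
  let ?e = "int ((3 * k + n) choose 2) - 3 * int (k choose 2)"
  have powi_add: "?x powi a * ?x ^ b = ?x powi (a + int b)" for a b
    by (simp only: power_int_add[OF disjI1[OF fls_X_nonzero]] power_int_of_nat)
  have "raft_term k m (n - m) = ?x powi ?e / ?P
      * (gauss_binom (inverse ?x) (m + r) r * (?x ^ (n - m) / qpoch ?x ?x (n - m)))" if "m \<le> n" for m
  proof -
    define j where "j = n - m"
    have n: "n = m + j" using that by (simp add: j_def)
    have "2 * (int ((3 * k + m) choose 2) - 3 * int (k choose 2) + int ((Suc j choose 2) + (3 * k + m) * j))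
        = 2 * (?e + int j)"
      unfolding right_diff_distrib distrib_left of_nat_add mult.left_commute[of 2 3] two_mult_choose_two n
      by (simp add: algebra_simps)
    then have "int ((3 * k + m) choose 2) - 3 * int (k choose 2) + int ((Suc j choose 2) + (3 * k + m) * j)
        = ?e + int j"
      by (metis mult_cancel_left zero_neq_numeral)
    then have "?x powi (int ((3 * k + m) choose 2) - 3 * int (k choose 2)) * ?x ^ ((Suc j choose 2) + (3 * k + m) * j)
        = ?x powi ?e * ?x ^ j"
      by (simp only: powi_add)
    moreover have "raft_term k m j
        = (?x powi (int ((3 * k + m) choose 2) - 3 * int (k choose 2)) * ?x ^ ((Suc j choose 2) + (3 * k + m) * j))
          / ?P * (gauss_binom (inverse ?x) (m + r) r * (1 / qpoch ?x ?x j))"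
      by (simp add: raft_term_def euler_term_def k mult_ac)
    ultimately show ?thesis unfolding j_def by simp
  qed
  then have "(\<Sum>m\<le>n. raft_term k m (n - m)) = ?x powi ?e / ?P
      * (\<Sum>m\<le>n. gauss_binom (inverse ?x) (m + r) r * (?x ^ (n - m) / qpoch ?x ?x (n - m)))"
    unfolding sum_distrib_left by (intro sum.cong) auto
  also have "\<dots> = ?x powi ?e / ?P * (inverse ?x ^ (r * n) / qpoch ?x ?x n)"
    by (simp only: sum_gauss_binom_inverse[OF fls_X_nonzero fls_X_power_neq_1])
  also have "\<dots> = raft_coeff k n"
  proof -
    have "2 * ?e = 2 * (int (3 * k\<^sup>2 + 2 * k * n + (Suc n choose 2)) + int (r * n))"
      unfolding right_diff_distrib distrib_left of_nat_add mult.left_commute[of 2 3] two_mult_choose_two k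
      by (simp add: algebra_simps power2_eq_square)
    then have "?e = int (3 * k\<^sup>2 + 2 * k * n + (Suc n choose 2)) + int (r * n)"
      by (metis mult_cancel_left zero_neq_numeral)
    then have "?x powi ?e = ?x ^ (3 * k\<^sup>2 + 2 * k * n + (Suc n choose 2)) * ?x ^ (r * n)"
      by (simp only: power_int_add[OF disjI1[OF fls_X_nonzero]] power_int_of_nat)
    moreover have "?x ^ (r * n) * inverse ?x ^ (r * n) = 1"
      by (simp only: power_mult_distrib[symmetric] right_inverse[OF fls_X_nonzero] power_one)
    ultimately have "?x powi ?e * inverse ?x ^ (r * n) = ?x ^ (3 * k\<^sup>2 + 2 * k * n + (Suc n choose 2))"
      by (simp only: mult.assoc mult_1_right)
    then show ?thesis unfolding raft_coeff_def times_divide_times_eq by simp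
  qed
  finally show ?thesis .
qed

lemma raft_inner_sum:
  assumes "k \<ge> 1"
  shows "(raft_coeff k has_sum
    (\<Sum>\<^sub>\<infinity>m\<in>{0..}. fls_X powi (int ((3 * k + m) choose 2) - 3 * int (k choose 2))
       * gauss_binom (inverse fls_X) (m + k - 1) (k - 1)
       * (qpoch_inf (- (fls_X ^ (3 * k + m + 1))) fls_X / qpoch (fls_X\<^sup>2) (fls_X\<^sup>2) k))) UNIV"
    (is "(_ has_sum (\<Sum>\<^sub>\<infinity>m\<in>_. ?B m)) _")
proof -
  have "(\<lambda>(m, j). raft_term k m j) summable_on UNIV \<times> UNIV"
  proof (rule summable_on_flsI[where d = "\<lambda>(m, j). m + j"])
    fix x :: "nat \<times> nat" and i assume "i < int (case x of (m, j) \<Rightarrow> m + j)"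
    then show "fls_nth (case x of (m, j) \<Rightarrow> raft_term k m j) i = 0"
      using raft_term_subdegree[OF assms, of "fst x" "snd x"]
      by (intro fls_eq0_below_subdegree) (auto simp: case_prod_beta)
  next
    fix N :: nat
    have "{x \<in> UNIV \<times> UNIV. (case x of (m, j) \<Rightarrow> m + j) < N} \<subseteq> {..N} \<times> {..N}" by auto
    then show "finite {x \<in> UNIV \<times> UNIV. (case x of (m, j) \<Rightarrow> m + j) < N}"
      by (rule finite_subset) simp
  qed
  then obtain V where V: "((\<lambda>(m, j). raft_term k m j) has_sum V) (UNIV \<times> UNIV)"
    by (auto simp: summable_on_def)
  have "(?B has_sum V) UNIV"
  proof (rule has_sum_SigmaD[OF V])
    fix m
    let ?c = "fls_X powi (int ((3 * k + m) choose 2) - 3 * int (k choose 2))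
       * gauss_binom (inverse fls_X) (m + k - 1) (k - 1) / qpoch (fls_X\<^sup>2) (fls_X\<^sup>2) k :: rat fls"
    have "((\<lambda>j. ?c * euler_term (3 * k + m) j) has_sum ?c * euler_sum (3 * k + m)) UNIV"
      by (rule has_sum_fls_mult_left[OF euler_sum_has_sum])
    then show "((\<lambda>j. case (m, j) of (m, j) \<Rightarrow> raft_term k m j) has_sum ?B m) UNIV"
      using qpoch_inf_eq_euler_sum[of "3 * k + m"] by (simp add: raft_term_def)
  qed
  then have B: "(\<Sum>\<^sub>\<infinity>m\<in>{0..}. ?B m) = V" by (simp add: infsumI atLeast_0)
  have "((\<lambda>(n, m). raft_term k m (n - m)) has_sum V) (SIGMA n:UNIV. {..n})"
    using V by (subst has_sum_reindex_bij_witness[where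
        i = "\<lambda>(m, j). (m + j, m)" and j = "\<lambda>(n, m). (m, n - m)" and T = "UNIV \<times> UNIV"
        and h = "\<lambda>(m, j). raft_term k m j" and s' = V]) auto
  then have "(raft_coeff k has_sum V) UNIV"
  proof (rule has_sum_SigmaD)
    fix n
    show "((\<lambda>m. case (n, m) of (n, m) \<Rightarrow> raft_term k m (n - m)) has_sum raft_coeff k n) {..n}"
      by (rule has_sum_finiteI) (simp_all add: raft_term_diagonal[OF assms])
  qed
  then show ?thesis unfolding B .
qed

lemma raft_coeff_0: "raft_coeff 0 = euler_term 0"
  by (rule ext) (simp add: raft_coeff_def euler_term_def)

lemma raft_coeff_subdegree: "int (k + n) \<le> fls_subdegree (raft_coeff k n)"
proof -
  have "fls_subdegree (raft_coeff k n) = int (3 * k\<^sup>2 + 2 * k * n + (Suc n choose 2))"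
    using qpoch_fls_X_squared[where 'a = rat] qpoch_fls_X[where 'a = rat]
    by (simp add: raft_coeff_def fls_divide_subdegree del: of_nat_mult of_nat_add)
  moreover have "k \<le> k\<^sup>2" by (simp add: power2_eq_square)
  ultimately show ?thesis using le_Suc_choose_two[of n] by linarith
qed

text \<open>
  With \<open>n = N - 2k\<close> the exponent \<open>3k\<^sup>2 + 2kn + n(n+1)/2\<close> equals \<open>N(N+1)/2 + k(k-1)\<close>, so that
  a power of \<open>q\<close> can be taken out of the sum.
\<close>

lemma raft_coeff_alternating_sum:
  "(\<Sum>k\<le>N div 2. (-1) ^ k * raft_coeff k (N - 2 * k)) = fls_X ^ N\<^sup>2 / qpoch fls_X fls_X N"
proof -
  let ?x = "fls_X :: rat fls"
  have "(-1) ^ k * raft_coeff k (N - 2 * k) = ?x ^ (Suc N choose 2)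
      * ((-1) ^ k * ?x ^ (k * (k - 1)) / (qpoch (?x\<^sup>2) (?x\<^sup>2) k * qpoch ?x ?x (N - 2 * k)))"
    if "k \<le> N div 2" for k
  proof -
    define n where "n = N - 2 * k"
    have N: "N = n + 2 * k" using that by (simp add: n_def)
    have "int (k * (k - 1)) = int k * (int k - 1)" by (cases k) (auto simp: algebra_simps)
    then have "2 * int (3 * k\<^sup>2 + 2 * k * n + (Suc n choose 2)) = 2 * int ((Suc N choose 2) + k * (k - 1))"
      unfolding of_nat_add distrib_left two_mult_choose_two N
      by (simp add: algebra_simps power2_eq_square)
    then have "3 * k\<^sup>2 + 2 * k * n + (Suc n choose 2) = (Suc N choose 2) + k * (k - 1)"
      by (metis mult_cancel_left zero_neq_numeral of_nat_eq_iff)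
    then show ?thesis unfolding raft_coeff_def n_def[symmetric] by (simp only:) (simp add: power_add)
  qed
  then have "(\<Sum>k\<le>N div 2. (-1) ^ k * raft_coeff k (N - 2 * k)) = ?x ^ (Suc N choose 2)
      * (?x ^ (N choose 2) / qpoch ?x ?x N)"
    unfolding sum_even_qpoch_alternating[OF fls_X_power_neq_1, symmetric] sum_distrib_left
    by (intro sum.cong) auto
  also have "\<dots> = ?x ^ ((Suc N choose 2) + (N choose 2)) / qpoch ?x ?x N" by (simp add: power_add)
  also have "(Suc N choose 2) + (N choose 2) = N\<^sup>2"
  proof -
    have "2 * int ((Suc N choose 2) + (N choose 2)) = 2 * int (N\<^sup>2)"
      unfolding of_nat_add distrib_left two_mult_choose_two by (simp add: algebra_simps power2_eq_square)
    then show ?thesis by (metis mult_cancel_left zero_neq_numeral of_nat_eq_iff)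
  qed
  finally show ?thesis .
qed

lemma raftless_generating_function:
  "((\<lambda>N. fls_X ^ N\<^sup>2 / qpoch fls_X fls_X N) has_sum
    fps_to_fls (Abs_fps (\<lambda>n. of_nat (card (raftless_partitions n))) :: rat fps)) UNIV"
proof -
  have "fps_to_fls (qpoch fps_X fps_X N) = qpoch (fls_X :: rat fls) fls_X N" for N
    by (induction N) (simp_all add: qpoch_self_Suc fls_times_fps_to_fls fps_to_fls_power del: power_Suc)
  then have "fps_to_fls (gap2_fps N 0) * qpoch fls_X fls_X N = fls_X ^ N\<^sup>2" for N
    using arg_cong[OF gap2_fps_closed_form[of N], of fps_to_fls]
    by (simp add: fls_times_fps_to_fls fps_to_fls_power)
  then have eq: "fls_X ^ N\<^sup>2 / qpoch fls_X fls_X N = fps_to_fls (gap2_fps N 0)" for N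
    using qpoch_fls_X(1)[where 'a = rat, of N] by (metis nonzero_eq_divide_eq)
  show ?thesis
    unfolding eq
  proof (rule has_sum_flsI[where d = "\<lambda>N. N"])
    fix N i assume "i < int N"
    moreover have "gap2_lists N 0 n = {}" if "n < N" for n
      using that length_le_sum_list by (fastforce simp: gap2_lists_def)
    ultimately show "fls_nth (fps_to_fls (gap2_fps N 0)) i = 0" by (simp add: gap2_fps_def)
  qed (simp_all add: card_raftless_partitions gap2_fps_def atMost_def)
qed

theorem theorem5:
  fixes q :: "rat fls"
  defines "q \<equiv> fls_X"
  shows "qpoch_inf (- q) q
      + (\<Sum>\<^sub>\<infinity>k\<in>{1..}. (- 1) ^ k *
          (\<Sum>\<^sub>\<infinity>m\<in>{0..}.
             q powi (int ((3 * k + m) choose 2) - 3 * int (k choose 2))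
             * gauss_binom (inverse q) (m + k - 1) (k - 1)
             * (qpoch_inf (- (q ^ (3 * k + m + 1))) q / qpoch (q ^ 2) (q ^ 2) k)))
    = fps_to_fls (Abs_fps (\<lambda>n. of_nat (card (raftless_partitions n))))"
    (is "_ + (\<Sum>\<^sub>\<infinity>k\<in>_. ?W k) = ?G")
proof -
  let ?c = "\<lambda>(k, n). (- 1) ^ k * raft_coeff k n"
  have summable: "?c summable_on A" for A
  proof (rule summable_on_flsI[where d = "\<lambda>(k, n). k + n"])
    fix x :: "nat \<times> nat" and i assume i: "i < int (case x of (k, n) \<Rightarrow> k + n)"
    obtain k n where x: "x = (k, n)" by fastforce
    have "fls_nth (raft_coeff k n) i = 0"
      using i raft_coeff_subdegree[of k n] by (intro fls_eq0_below_subdegree) (simp add: x)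
    then show "fls_nth (?c x) i = 0" by (cases "even k") (simp_all add: x)
  next
    fix N :: nat
    have "{x \<in> A. (case x of (k, n) \<Rightarrow> k + n) < N} \<subseteq> {..N} \<times> {..N}" by auto
    then show "finite {x \<in> A. (case x of (k, n) \<Rightarrow> k + n) < N}"
      by (rule finite_subset) simp
  qed
  have W: "((\<lambda>n. ?c (k, n)) has_sum ?W k) UNIV" if "k \<in> {1..}" for k
    using has_sum_fls_mult_left[OF raft_inner_sum, of k "(- 1) ^ k"] that by (simp add: q_def)
  obtain S1 where S1: "(?c has_sum S1) ({1..} \<times> UNIV)"
    using summable by (auto simp: summable_on_def)
  have W_sum: "(?W has_sum S1) {1..}" by (rule has_sum_SigmaD[OF S1 W])
  \<comment> \<open>The product outside the sum fits the pattern of the inner sums as the case \<open>k = 0\<close>.\<close>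
  define F where "F = (\<lambda>k. if k = 0 then euler_sum 0 else ?W k)"
  have F: "((\<lambda>n. ?c (k, n)) has_sum F k) UNIV" for k
    using W[of k] euler_sum_has_sum[of 0] by (cases "k = 0") (auto simp: F_def raft_coeff_0)
  have "(F has_sum S1) {1..}" using W_sum by (subst has_sum_cong[of _ _ ?W]) (auto simp: F_def)
  then have "(F has_sum F 0 + S1) (insert 0 {1..})" by (intro has_sum_insert) auto
  also have "insert 0 {1..} = (UNIV :: nat set)" by auto
  finally have F_sum: "(F has_sum F 0 + S1) UNIV" .
  obtain S where S: "(?c has_sum S) (UNIV \<times> UNIV)"
    using summable by (auto simp: summable_on_def)
  have "F 0 + S1 = S" by (rule has_sum_unique[OF F_sum has_sum_SigmaD[OF S F]])
  moreover have "S = ?G"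
  proof -
    \<comment> \<open>Group the pairs \<open>(k, n)\<close> by the number \<open>N = 2k + n\<close> of parts.\<close>
    have "((\<lambda>(N, k). (- 1) ^ k * raft_coeff k (N - 2 * k)) has_sum S) (SIGMA N:UNIV. {..N div 2})"
      using S by (subst has_sum_reindex_bij_witness[where
          i = "\<lambda>(k, n). (n + 2 * k, k)" and j = "\<lambda>(N, k). (k, N - 2 * k)" and T = "UNIV \<times> UNIV"
          and h = ?c and s' = S]) auto
    then have "((\<lambda>N. fls_X ^ N\<^sup>2 / qpoch fls_X fls_X N) has_sum S) UNIV"
    proof (rule has_sum_SigmaD)
      fix N
      show "((\<lambda>k. case (N, k) of (N, k) \<Rightarrow> (- 1) ^ k * raft_coeff k (N - 2 * k)) has_sum
          fls_X ^ N\<^sup>2 / qpoch fls_X fls_X N) {..N div 2}"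
        by (rule has_sum_finiteI) (simp_all add: raft_coeff_alternating_sum)
    qed
    then show ?thesis using raftless_generating_function by (rule has_sum_unique)
  qed
  moreover have "qpoch_inf (- q) q = F 0"
    using qpoch_inf_eq_euler_sum[of 0] by (simp add: F_def q_def)
  ultimately show ?thesis using infsumI[OF W_sum] by simp
qed

end
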